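(* Let $(X,d)$ be a complete metric space and let $f\colon X\to[-\infty,+\infty]$ be a lower semicontinuous proper function that is bounded below and has the Kurdyka-{\L}ojasiewicz property for minimization with a concave desingularizer $\phi$. Let $\alpha,\beta>0$. Then there exists $\varepsilon>0$ such that every sequence $(x_k)_{k\ge0}$ in $X$ with $f(x_0)<\inf f+\varepsilon$ and satisfying, for all $k\ge0$, the slope-descent conditions $$f(x_k)-f(x_{k+1})\ \ge\ \alpha\, d^2(x_k,x_{k+1})\qquad\text{and}\qquad d(x_k,x_{k+1})\ \ge\ \beta\,|\overline{\nabla} f|(x_{k+1})$$ converges to a minimizer of $f$.
   Context: Let $(X,d)$ be a metric space and $f\colon X\to[-\infty,+\infty]$. The function $f$ is proper if it never takes the value $-\infty$ and its domain $\mathrm{dom}\,f=\{x: f(x)<+\infty\}$ is nonempty. Slope: at a point $x$ with $f(x)$ finite, $|\nabla f|(x)$ is the infimum of those $\epsilon>0$ for which $x$ is a local minimizer of $y\mapsto f(y)+\epsilon\, d(x,y)$ (with $\inf\emptyset=+\infty$); if $f(x)=+\infty$ then $|\nabla f|(x)=+\infty$. Limiting slope: for $\bar x\in\mathrm{dom}\,f$, $|\overline{\nabla} f|(\bar x)=\liminf_{x\to\bar x,\ f(x)\to f(\bar x)}|\nabla f|(x)$ (points $x=\bar x$ allowed), i.e. $\lim_{r\downarrow0}\inf\{|\nabla f|(x): d(x,\bar x)<r,\ |f(x)-f(\bar x)|<r\}$; it is taken to be $+\infty$ where $f=+\infty$. A desingularizer is a continuous function $\phi\colon[0,\infty)\to[0,\infty)$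 with $\phi(0)=0$ that has a continuous, strictly positive derivative on $(0,+\infty)$ (with the convention $\phi(+\infty)=+\infty$). For $f$ lower semicontinuous, proper and bounded below, put $g=f-\inf f$ (the gap). $f$ has the Kurdyka-{\L}ojasiewicz (KL) property for minimization, with desingularizer $\phi$, if there exists $\rho>0$ such that $|\nabla(\phi\circ g)|(x)\ge1$ for all $x\in X$ with $0<g(x)<\rho$. *)

theory Defs
  imports "HOL-Analysis.Analysis"
begin

definition proper_fun :: "('a \<Rightarrow> ereal) \<Rightarrow> bool" where
  "proper_fun f \<longleftrightarrow> (\<forall>x. f x \<noteq> -\<infinity>) \<and> (\<exists>x. f x < \<infinity>)"

definition lower_semicont :: "('a::topological_space \<Rightarrow> ereal) \<Rightarrow> bool" where
  "lower_semicont f \<longleftrightarrow> (\<forall>x. f x \<le> Liminf (at x) f)"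

definition bounded_below_fun :: "('a \<Rightarrow> ereal) \<Rightarrow> bool" where
  "bounded_below_fun f \<longleftrightarrow> (\<exists>m::real. \<forall>x. ereal m \<le> f x)"

definition local_minimizer :: "('a::topological_space \<Rightarrow> ereal) \<Rightarrow> 'a \<Rightarrow> bool" where
  "local_minimizer h x \<longleftrightarrow> (\<forall>\<^sub>F y in nhds x. h x \<le> h y)"

definition global_minimizer :: "('a \<Rightarrow> ereal) \<Rightarrow> 'a \<Rightarrow> bool" where
  "global_minimizer h x \<longleftrightarrow> (\<forall>y. h x \<le> h y)"

(* In ereal the infimum of the empty set is \<infinity>. The value where f x = -\<infinity> is arbitrary;
   proper functions never take that value. *)
definition slope :: "('a::metric_space \<Rightarrow> ereal) \<Rightarrow> 'a \<Rightarrow> ereal" where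
  "slope f x =
     (if \<bar>f x\<bar> \<noteq> \<infinity>
      then Inf {ereal e | e. e > 0 \<and> local_minimizer (\<lambda>y. f y + ereal (e * dist x y)) x}
      else \<infinity>)"

(* The filter expresses "x \<rightarrow> xbar and f x \<rightarrow> f xbar"; since it uses nhds rather than at, the
   point xbar itself takes part in the lower limit. *)
definition limiting_slope :: "('a::metric_space \<Rightarrow> ereal) \<Rightarrow> 'a \<Rightarrow> ereal" where
  "limiting_slope f xbar =
     (if \<bar>f xbar\<bar> \<noteq> \<infinity>
      then Liminf (inf (nhds xbar) (filtercomap f (nhds (f xbar)))) (slope f)
      else \<infinity>)"

lemma eventually_nhds_ereal_dist:
  fixes c :: ereal
  assumes "\<bar>c\<bar> \<noteq> \<infinity>"
  shows "(\<forall>\<^sub>F t in nhds c. P t) \<longleftrightarrow> (\<exists>r::real>0. \<forall>t. \<bar>t - c\<bar> < ereal r \<longrightarrow> P t)"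
proof -
  obtain a where a: "c = ereal a" using assms by auto
  have *: "(\<bar>t - c\<bar> < ereal r) \<longleftrightarrow> (\<exists>s. t = ereal s \<and> dist s a < r)" for t r
    by (cases t) (auto simp: a dist_real_def)
  have "(\<forall>\<^sub>F t in nhds c. P t) \<longleftrightarrow> (\<forall>\<^sub>F s in nhds a. P (ereal s))"
    by (simp add: a nhds_ereal eventually_filtermap)
  also have "\<dots> \<longleftrightarrow> (\<exists>r>0. \<forall>s. dist s a < r \<longrightarrow> P (ereal s))"
    by (simp add: eventually_nhds_metric)
  finally show ?thesis unfolding * by auto
qed

lemma eventually_limiting_slope_filter:
  fixes f :: "'a::metric_space \<Rightarrow> ereal"
  assumes "\<bar>f xbar\<bar> \<noteq> \<infinity>"
  shows "eventually P (inf (nhds xbar) (filtercomap f (nhds (f xbar)))) \<longleftrightarrow>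
    (\<exists>r::real>0. \<forall>x. dist x xbar < r \<and> \<bar>f x - f xbar\<bar> < ereal r \<longrightarrow> P x)" (is "?L \<longleftrightarrow> ?R")
proof
  assume ?L
  then obtain Q R where Q: "eventually Q (nhds xbar)"
    and R: "\<forall>\<^sub>F x in filtercomap f (nhds (f xbar)). R x" and P: "\<And>x. Q x \<Longrightarrow> R x \<Longrightarrow> P x"
    by (auto simp: eventually_inf)
  from Q obtain r1 where r1: "r1 > 0" "\<And>x. dist x xbar < r1 \<Longrightarrow> Q x"
    by (auto simp: eventually_nhds_metric)
  from R obtain r2 :: real where r2: "r2 > 0" "\<And>x. \<bar>f x - f xbar\<bar> < ereal r2 \<Longrightarrow> R x"
    unfolding eventually_filtercomap eventually_nhds_ereal_dist[OF assms] by metis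
  show ?R
  proof (intro exI[of _ "min r1 r2"] conjI allI impI)
    fix x assume x: "dist x xbar < min r1 r2 \<and> \<bar>f x - f xbar\<bar> < ereal (min r1 r2)"
    moreover have "ereal (min r1 r2) \<le> ereal r2" by simp
    ultimately have "\<bar>f x - f xbar\<bar> < ereal r2" by (meson less_le_trans)
    with x show "P x" by (intro P r1(2) r2(2)) auto
  qed (use r1 r2 in auto)
next
  assume ?R
  then obtain r :: real where r: "r > 0"
    "\<And>x. dist x xbar < r \<Longrightarrow> \<bar>f x - f xbar\<bar> < ereal r \<Longrightarrow> P x" by auto
  have "\<forall>\<^sub>F x in nhds xbar. dist x xbar < r"
    using r(1) by (auto simp: eventually_nhds_metric)
  moreover have "\<forall>\<^sub>F x in filtercomap f (nhds (f xbar)). \<bar>f x - f xbar\<bar> < ereal r"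
    unfolding eventually_filtercomap eventually_nhds_ereal_dist[OF assms]
    by (intro exI[of _ "\<lambda>t. \<bar>t - f xbar\<bar> < ereal r"] conjI exI[of _ r]) (use r(1) in simp_all)
  ultimately have "\<forall>\<^sub>F x in inf (nhds xbar) (filtercomap f (nhds (f xbar))).
      dist x xbar < r \<and> \<bar>f x - f xbar\<bar> < ereal r"
    unfolding eventually_inf by blast
  then show ?L by (rule eventually_mono) (use r(2) in simp)
qed

lemma limiting_slope_tendsto:
  fixes f :: "'a::metric_space \<Rightarrow> ereal"
  assumes fin: "\<bar>f xbar\<bar> \<noteq> \<infinity>"
  shows "((\<lambda>r. INF x\<in>{x. dist x xbar < r \<and> \<bar>f x - f xbar\<bar> < ereal r}. slope f x)
           \<longlongrightarrow> limiting_slope f xbar) (at_right (0::real))"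
    (is "(?I \<longlongrightarrow> _) _")
proof -
  let ?F = "inf (nhds xbar) (filtercomap f (nhds (f xbar)))"
  have L: "limiting_slope f xbar = Liminf ?F (slope f)"
    using fin by (simp add: limiting_slope_def)
  have mono: "?I r \<ge> ?I s" if "r \<le> s" for r s :: real
  proof (rule INF_superset_mono)
    have "ereal r \<le> ereal s" using that by simp
    then show "{x. dist x xbar < r \<and> \<bar>f x - f xbar\<bar> < ereal r}
        \<subseteq> {x. dist x xbar < s \<and> \<bar>f x - f xbar\<bar> < ereal s}"
      using that less_le_trans[of _ "ereal r" "ereal s"] by auto
  qed simp
  show ?thesis unfolding L
  proof (rule order_tendstoI)
    fix a assume "a < Liminf ?F (slope f)"
    then obtain P where P: "eventually P ?F" "a < Inf (slope f ` Collect P)"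
      by (auto simp: Liminf_def less_SUP_iff)
    from P(1) obtain r :: real where r: "r > 0"
      "\<And>x. dist x xbar < r \<Longrightarrow> \<bar>f x - f xbar\<bar> < ereal r \<Longrightarrow> P x"
      unfolding eventually_limiting_slope_filter[where f=f and xbar=xbar, OF fin] by auto
    have "Inf (slope f ` Collect P) \<le> ?I r" using r(2) by (intro INF_superset_mono) auto
    with P(2) have "a < ?I r" by simp
    then have "a < ?I s" if "s < r" for s
      using mono[of s r] that by (meson less_imp_le less_le_trans)
    then show "\<forall>\<^sub>F r in at_right 0. a < ?I r"
      unfolding eventually_at_right_field using r(1) by (intro exI[of _ r]) simp
  next
    fix a assume a: "Liminf ?F (slope f) < a"
    have "?I r \<le> Liminf ?F (slope f)" if "r > 0" for r :: real
    proof -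
      have "eventually (\<lambda>x. dist x xbar < r \<and> \<bar>f x - f xbar\<bar> < ereal r) ?F"
        unfolding eventually_limiting_slope_filter[where f=f and xbar=xbar, OF fin]
        by (intro exI[of _ r]) (use that in simp)
      then show ?thesis unfolding Liminf_def by (intro SUP_upper) auto
    qed
    then have "?I r < a" if "r > 0" for r :: real
      using a that by (meson le_less_trans)
    then show "\<forall>\<^sub>F r in at_right 0. ?I r < a"
      unfolding eventually_at_right_field by (intro exI[of _ 1]) simp
  qed
qed

definition gap :: "('a \<Rightarrow> ereal) \<Rightarrow> 'a \<Rightarrow> ereal" where
  "gap f x = f x - (INF y. f y)"

(* Only the restriction of \<phi> to {0..} is meaningful. *)
definition desingularizer :: "(real \<Rightarrow> real) \<Rightarrow> bool" where
  "desingularizer \<phi> \<longleftrightarrow>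
     \<phi> \<in> {0..} \<rightarrow> {0..} \<and> continuous_on {0..} \<phi> \<and> \<phi> 0 = 0 \<and>
     (\<exists>\<phi>'. (\<forall>t>0. (\<phi> has_real_derivative \<phi>' t) (at t)) \<and>
           continuous_on {0<..} \<phi>' \<and> (\<forall>t>0. \<phi>' t > 0))"

(* The convention \<phi>(\<infinity>) = \<infinity>. Used only at nonnegative arguments, so the value at -\<infinity> is
   irrelevant. *)
definition extend_desing :: "(real \<Rightarrow> real) \<Rightarrow> ereal \<Rightarrow> ereal" where
  "extend_desing \<phi> t = (if t = \<infinity> then \<infinity> else ereal (\<phi> (real_of_ereal t)))"

definition KL_minimization :: "('a::metric_space \<Rightarrow> ereal) \<Rightarrow> (real \<Rightarrow> real) \<Rightarrow> bool" where
  "KL_minimization f \<phi> \<longleftrightarrow>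
     desingularizer \<phi> \<and>
     (\<exists>\<rho>::real>0. \<forall>x. 0 < gap f x \<and> gap f x < ereal \<rho> \<longrightarrow>
        slope (extend_desing \<phi> \<circ> gap f) x \<ge> 1)"

end

theory Submission
  imports Defs
begin

text \<open>
  A chain rule for the slope turns the KL inequality into \<open>limiting_slope f x \<ge> 1 / \<phi>' (gap f x)\<close>.
  Writing \<open>d k\<close> for the \<open>k\<close>-th step length and \<open>g k\<close> for the \<open>k\<close>-th gap, the second descent
  condition gives \<open>d k * \<phi>' (g (k+1)) \<ge> \<beta>\<close>. With the first one, concavity of \<open>\<phi>\<close> yields
  \<open>\<alpha> \<beta> (d (k+1))\<^sup>2 \<le> d k * (\<phi> (g (k+1)) - \<phi> (g (k+2)))\<close>, so by AM-GM the step lengths telescope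
  and the sequence has finite length. As \<open>d k \<longlonglongrightarrow> 0\<close> while \<open>d k * \<phi>' (g (k+1)) \<ge> \<beta>\<close>, the gaps
  cannot stay away from \<open>0\<close>; lower semicontinuity finishes the proof.
\<close>

section \<open>Chain rule bounds for the slope and the limiting slope\<close>

text \<open>Suppose some \<open>e < 1 / \<phi>' t\<close> were admissible in the infimum defining
  \<open>slope f x\<close>. Near \<open>t\<close> the increasing function \<open>\<phi>\<close>
  distorts decreases by a factor less than some \<open>c\<close> with \<open>c * e < 1\<close>, so
  \<open>c * e\<close> is admissible for the composed function, whose slope would then be below
  1.\<close>

lemma slope_ge_inverse_deriv:
  fixes f :: "'a::metric_space \<Rightarrow> ereal"
  assumes m: "(INF y. f y) = ereal m"
    and deriv: "\<And>t. t > 0 \<Longrightarrow> (\<phi> has_real_derivative \<phi>' t) (at t)"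
    and pos: "\<And>t. t > 0 \<Longrightarrow> \<phi>' t > 0"
    and fx: "f x = ereal (m + t)" and t: "t > 0"
    and sl: "slope (extend_desing \<phi> \<circ> gap f) x \<ge> 1"
  shows "ereal (1 / \<phi>' t) \<le> slope f x"
proof -
  have "1 / \<phi>' t \<le> e"
    if e: "e > 0" and lm: "local_minimizer (\<lambda>y. f y + ereal (e * dist x y)) x" for e
  proof (rule ccontr)
    assume "\<not> 1 / \<phi>' t \<le> e"
    with e pos[OF t] have "\<phi>' t < 1 / e" by (simp add: field_simps)
    then obtain c where c: "\<phi>' t < c" "c < 1 / e" using dense by blast
    have cpos: "c > 0" using c pos[OF t] by linarith
    \<comment> \<open>Since \<open>c > \<phi>' t\<close>, this function has negative derivative at
      \<open>t\<close>; its values just to the left of \<open>t\<close> are therefore larger, which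
      gives \<open>\<phi> (t - h) > \<phi> t - c * h\<close>.\<close>
    have "((\<lambda>u. \<phi> u - c * u) has_real_derivative (\<phi>' t - c * 1)) (at t)"
      by (intro DERIV_diff deriv[OF t] DERIV_cmult DERIV_ident)
    then obtain r where r: "r > 0"
      "\<And>h. 0 < h \<Longrightarrow> h < r \<Longrightarrow> \<phi> t - c * t < \<phi> (t - h) - c * (t - h)"
      using DERIV_neg_dec_left[of "\<lambda>u. \<phi> u - c * u" "\<phi>' t - c * 1" t] c(1) by auto
    have gx: "gap f x = ereal t" by (simp add: gap_def m fx)
    let ?h = "extend_desing \<phi> \<circ> gap f"
    have "local_minimizer (\<lambda>y. ?h y + ereal (c * e * dist x y)) x"
      unfolding local_minimizer_def
    proof -
      \<comment> \<open>The radius makes \<open>s = e * dist x y\<close> smaller than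
        \<open>r\<close>, so that the estimate above applies, and smaller than \<open>t\<close>, so
        that \<open>t - s\<close> stays where \<open>\<phi>\<close> is known to increase.\<close>
      have near: "\<forall>\<^sub>F y in nhds x. dist y x < min t r / e"
        using r(1) t e unfolding eventually_nhds_metric
        by (intro exI[of _ "min t r / e"]) auto
      have "\<forall>\<^sub>F y in nhds x. f x + ereal (e * dist x x) \<le> f y + ereal (e * dist x y)"
        using lm by (simp add: local_minimizer_def)
      with near show "\<forall>\<^sub>F y in nhds x.
          ?h x + ereal (c * e * dist x x) \<le> ?h y + ereal (c * e * dist x y)"
      proof eventually_elim
        case (elim y)
        define s where "s = e * dist x y"
        have s: "0 \<le> s" "s < t" "s < r"
          using elim(1) e by (auto simp: s_def dist_commute field_simps)
        show ?case
        proof (cases "f y")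
          case (real b)
          have b: "t - s \<le> b - m" using elim(2) by (simp add: fx real s_def)
          have "\<phi> t - c * s \<le> \<phi> (t - s)"
            using r(2)[of s] s by (cases "s = 0") (auto simp: algebra_simps)
          also have "\<dots> \<le> \<phi> (b - m)"
          proof (rule DERIV_nonneg_imp_nondecreasing[OF b])
            fix u assume "t - s \<le> u"
            then have "u > 0" using s by linarith
            then show "\<exists>y. DERIV \<phi> u :> y \<and> 0 \<le> y"
              using deriv pos less_imp_le by blast
          qed
          finally show ?thesis
            by (simp add: extend_desing_def gap_def m fx real s_def mult.assoc)
        next
          case PInf
          then show ?thesis by (simp add: extend_desing_def gap_def m)
        next
          case MInf
          have "(INF y. f y) \<le> f y" by (rule INF_lower) simp
          then show ?thesis by (simp add: MInf m)
        qed
      qed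
    qed
    moreover have "c * e > 0" using cpos e by simp
    moreover have "\<bar>?h x\<bar> \<noteq> \<infinity>" by (simp add: extend_desing_def gx)
    ultimately have "slope ?h x \<le> ereal (c * e)"
      unfolding slope_def by (auto intro!: Inf_lower)
    also have "\<dots> < 1" using c(2) e by (simp add: field_simps)
    finally show False using sl by simp
  qed
  then show ?thesis
    unfolding slope_def by (auto simp: fx intro!: Inf_greatest)
qed

text \<open>The filter of the limiting slope forces \<open>f y\<close> to tend to
  \<open>f x\<close>, so the gaps tend to \<open>t\<close>. The pointwise bounds
  \<open>1 / \<phi>' (gap f y)\<close> then converge to \<open>1 / \<phi>' t\<close> by continuity
  of \<open>\<phi>'\<close>.\<close>

lemma limiting_slope_ge_inverse_deriv:
  fixes f :: "'a::metric_space \<Rightarrow> ereal"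
  assumes m: "(INF y. f y) = ereal m"
    and deriv: "\<And>t. t > 0 \<Longrightarrow> (\<phi> has_real_derivative \<phi>' t) (at t)"
    and pos: "\<And>t. t > 0 \<Longrightarrow> \<phi>' t > 0"
    and cont: "continuous_on {0<..} \<phi>'"
    and KL: "\<And>y. 0 < gap f y \<Longrightarrow> gap f y < ereal \<rho> \<Longrightarrow> slope (extend_desing \<phi> \<circ> gap f) y \<ge> 1"
    and fx: "f x = ereal (m + t)" and t: "0 < t" "t < \<rho>"
  shows "ereal (1 / \<phi>' t) \<le> limiting_slope f x"
proof -
  let ?F = "inf (nhds x) (filtercomap f (nhds (f x)))"
  have "(f \<longlongrightarrow> f x) ?F"
    by (rule filterlim_mono[OF filterlim_filtercomap]) auto
  then have f_lim: "(f \<longlongrightarrow> ereal (m + t)) ?F" by (simp add: fx)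
  \<comment> \<open>As \<open>0 < t < \<rho>\<close>, nearby points have a real value and lie in the
    range of the KL inequality.\<close>
  have fin: "\<forall>\<^sub>F y in ?F. ereal m < f y \<and> f y < ereal (m + \<rho>)"
    using t by (intro eventually_conj order_tendstoD[OF f_lim]) auto
  have g_lim: "((\<lambda>y. real_of_ereal (f y) - m) \<longlongrightarrow> t) ?F"
    using tendsto_diff[OF lim_real_of_ereal[OF f_lim] tendsto_const[of m]] by simp
  have "isCont \<phi>' t"
    using cont t by (simp add: continuous_on_eq_continuous_at)
  then have lim: "((\<lambda>y. 1 / \<phi>' (real_of_ereal (f y) - m)) \<longlongrightarrow> 1 / \<phi>' t) ?F"
    using pos[OF t(1)] by (intro tendsto_intros isCont_tendsto_compose[OF _ g_lim]) auto
  have "ereal (1 / \<phi>' t) \<le> Liminf ?F (slope f)"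
    unfolding le_Liminf_iff
  proof (intro allI impI)
    fix a assume "a < ereal (1 / \<phi>' t)"
    then have "\<forall>\<^sub>F y in ?F. a < ereal (1 / \<phi>' (real_of_ereal (f y) - m))"
      using order_tendstoD(1)[OF tendsto_ereal[OF lim]] by blast
    with fin show "\<forall>\<^sub>F y in ?F. a < slope f y"
    proof eventually_elim
      case (elim y)
      then obtain b where b: "f y = ereal b" "m < b" "b < m + \<rho>"
        by (cases "f y") auto
      have "ereal (1 / \<phi>' (b - m)) \<le> slope f y"
        by (rule slope_ge_inverse_deriv[OF m deriv pos]) (use b in \<open>auto intro!: KL simp: gap_def m\<close>)
      with elim b show ?case by auto
    qed
  qed
  then show ?thesis by (simp add: limiting_slope_def fx)
qed

section \<open>Summability, lower semicontinuity along sequences and concavity\<close>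

lemma summable_if_square_le_telescoping:
  fixes d p :: "nat \<Rightarrow> real"
  assumes d: "\<And>k. d k \<ge> 0" and p: "\<And>k. p k \<ge> 0" and dec: "\<And>k. p (Suc k) \<le> p k"
    and le: "\<And>k. (d (Suc k))\<^sup>2 \<le> d k * (p k - p (Suc k))"
  shows "summable d"
proof -
  \<comment> \<open>AM-GM for \<open>d k\<close> and \<open>p k - p (Suc k)\<close>, with squares
    compared to avoid square roots.\<close>
  have amgm: "2 * d (Suc k) \<le> d k + (p k - p (Suc k))" for k
  proof (rule power2_le_imp_le)
    have "(2 * d (Suc k))\<^sup>2 \<le> 4 * (d k * (p k - p (Suc k)))"
      using le[of k] by (simp add: power_mult_distrib)
    also have "\<dots> \<le> (d k + (p k - p (Suc k)))\<^sup>2"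
      using zero_le_power2[of "d k - (p k - p (Suc k))"]
      by (simp add: power2_eq_square algebra_simps)
    finally show "(2 * d (Suc k))\<^sup>2 \<le> (d k + (p k - p (Suc k)))\<^sup>2" .
  qed (use d[of k] dec[of k] in linarith)
  \<comment> \<open>Of the two copies of \<open>d (Suc k)\<close> in \<open>amgm\<close>, one enters
    the sum and the other replaces the boundary term \<open>d k\<close>.\<close>
  have "(\<Sum>k<n. d (Suc k)) + d n \<le> d 0 + (p 0 - p n)" for n
  proof (induction n)
    case (Suc n)
    then show ?case using amgm[of n] by simp
  qed simp
  then have "(\<Sum>k<n. d (Suc k)) \<le> d 0 + p 0" for n
    using d[of n] p[of n] by (smt (verit))
  then have "summable (\<lambda>k. d (Suc k))"
    using d by (intro summableI_nonneg_bounded)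
  then show ?thesis by (simp only: summable_Suc_iff)
qed

lemma Cauchy_if_summable_dist:
  fixes x :: "nat \<Rightarrow> 'a::metric_space"
  assumes "summable (\<lambda>k. dist (x k) (x (Suc k)))"
  shows "Cauchy x"
proof -
  have le: "dist (x k) (x n) \<le> (\<Sum>i=k..<n. dist (x i) (x (Suc i)))" if "k \<le> n" for k n
    using that
  proof (induction n rule: dec_induct)
    case (step n)
    have "dist (x k) (x (Suc n)) \<le> dist (x k) (x n) + dist (x n) (x (Suc n))"
      by (rule dist_triangle)
    with step show ?case by simp
  qed simp
  show ?thesis
    unfolding Cauchy_altdef
  proof (intro allI impI)
    fix e :: real assume "e > 0"
    then obtain N where N: "\<And>k n. k \<ge> N \<Longrightarrow> norm (\<Sum>i=k..<n. dist (x i) (x (Suc i))) < e"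
      using assms unfolding summable_Cauchy by blast
    have "dist (x k) (x n) < e" if "k \<ge> N" "n > k" for k n
      using le[of k n] N[of k n] that by (simp add: sum_nonneg)
    then show "\<exists>N. \<forall>k\<ge>N. \<forall>n>k. dist (x k) (x n) < e" by blast
  qed
qed

lemma lower_semicont_le_lim:
  fixes f :: "'a::t2_space \<Rightarrow> ereal"
  assumes lsc: "lower_semicont f" and x: "x \<longlonglongrightarrow> z" and f: "(\<lambda>k. f (x k)) \<longlonglongrightarrow> l"
  shows "f z \<le> l"
proof (rule ccontr)
  assume "\<not> f z \<le> l"
  then obtain c where c: "l < c" "c < f z" using dense[of l "f z"] by (auto simp: not_le)
  have "c < Liminf (at z) f" using c(2) lsc unfolding lower_semicont_def by (meson less_le_trans)
  then have "\<forall>\<^sub>F y in at z. c < f y"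
    using less_LiminfD by blast
  \<comment> \<open>The \<open>Liminf\<close> at \<open>z\<close> ignores \<open>z\<close> itself,
    which the sequence may visit; there \<open>c < f z\<close> fills in.\<close>
  then have "\<forall>\<^sub>F y in nhds z. c < f y"
    using c(2) unfolding eventually_at_filter by (auto elim: eventually_mono)
  then have "\<forall>\<^sub>F k in sequentially. c < f (x k)"
    using x unfolding filterlim_iff by blast
  moreover have "\<forall>\<^sub>F k in sequentially. f (x k) < c"
    using order_tendstoD(2)[OF f c(1)] .
  ultimately have "\<forall>\<^sub>F k in sequentially. False" by eventually_elim simp
  then show False by simp
qed

lemma concave_on_tangent_le:
  fixes \<phi> :: "real \<Rightarrow> real"
  assumes "concave_on {0..} \<phi>" and "(\<phi> has_real_derivative D) (at s)" and "0 < s" "0 \<le> t"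
  shows "D * (s - t) \<le> \<phi> s - \<phi> t"
proof -
  have "- D * (t - s) \<le> - \<phi> t - - \<phi> s"
  proof (rule convex_on_imp_above_tangent[of "{0..}" "\<lambda>u. - \<phi> u"])
    show "((\<lambda>u. - \<phi> u) has_real_derivative - D) (at s within {0..})"
      using assms(2) by (intro derivative_intros) (rule has_field_derivative_at_within)
  qed (use assms in \<open>auto simp: concave_on_def\<close>)
  then show ?thesis by (simp add: algebra_simps)
qed

section \<open>Convergence of descent sequences\<close>

text \<open>The KL radius \<open>\<rho>\<close> itself serves as the threshold: gaps decrease along
  the sequence, so a start below \<open>\<rho>\<close> keeps every iterate in the range of the KL
  inequality.\<close>

lemma KL_minimization_descent_converges:
  fixes f :: "'a::complete_space \<Rightarrow> ereal"
  assumes lsc: "lower_semicont f" and m: "(INF y. f y) = ereal m"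
    and desing: "desingularizer \<phi>" and conc: "concave_on {0..} \<phi>"
    and deriv: "\<And>t. t > 0 \<Longrightarrow> (\<phi> has_real_derivative \<phi>' t) (at t)"
    and pos: "\<And>t. t > 0 \<Longrightarrow> \<phi>' t > 0"
    and cont: "continuous_on {0<..} \<phi>'"
    and KL: "\<And>y. 0 < gap f y \<Longrightarrow> gap f y < ereal \<rho> \<Longrightarrow> slope (extend_desing \<phi> \<circ> gap f) y \<ge> 1"
    and \<alpha>: "\<alpha> > 0" and \<beta>: "\<beta> > 0"
    and x0: "f (x 0) < ereal (m + \<rho>)"
    and desc: "\<And>k. f (x k) - f (x (Suc k)) \<ge> ereal (\<alpha> * (dist (x k) (x (Suc k)))\<^sup>2)"
    and sl: "\<And>k. ereal (dist (x k) (x (Suc k))) \<ge> ereal \<beta> * limiting_slope f (x (Suc k))"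
  shows "\<exists>z. x \<longlonglongrightarrow> z \<and> global_minimizer f z"
proof -
  define d where "d k = dist (x k) (x (Suc k))" for k
  define g where "g k = real_of_ereal (f (x k)) - m" for k
  have low: "ereal m \<le> f y" for y
    using INF_lower[of y UNIV f] by (simp add: m)
  \<comment> \<open>If \<open>f (x k)\<close> is finite and the next value were infinite, their
    difference would be \<open>-\<infinity>\<close>, against the descent condition.\<close>
  have fin: "f (x k) < \<infinity>" for k
  proof (induction k)
    case 0
    show ?case using x0 less_trans by fastforce
  next
    case (Suc k)
    then show ?case using desc[of k] low[of "x k"] by (cases "f (x k)") auto
  qed
  have f: "f (x k) = ereal (m + g k)" for k
    using fin[of k] low[of "x k"] by (cases "f (x k)") (auto simp: g_def)
  have g0: "g k \<ge> 0" for k using low[of "x k"] by (simp add: f)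
  have gd: "\<alpha> * (d k)\<^sup>2 \<le> g k - g (Suc k)" for k
    using desc[of k] by (simp add: f d_def)
  have g_dec: "g (Suc k) \<le> g k" for k
    using gd[of k] \<alpha> zero_le_power2[of "d k"] mult_nonneg_nonneg[of \<alpha> "(d k)\<^sup>2"] by linarith
  then have "decseq g" by (simp add: decseq_Suc_iff)
  have g_lt: "g k < \<rho>" for k
    using decseqD[OF \<open>decseq g\<close>, of 0 k] x0 by (simp add: f)
  have min: "global_minimizer f z" if "f z \<le> ereal m" for z
    using low that order_trans unfolding global_minimizer_def by blast
  show ?thesis
  proof (cases "\<exists>k. g k = 0")
    \<comment> \<open>At zero gap the KL inequality says nothing, but the first descent condition
      forces all later steps to vanish.\<close>
    case True
    then obtain N where N: "g N = 0" by blast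
    have gN: "g k = 0" if "k \<ge> N" for k
      using decseqD[OF \<open>decseq g\<close> that] g0[of k] N by simp
    have step: "x (Suc k) = x k" if "k \<ge> N" for k
    proof -
      have "\<alpha> * (d k)\<^sup>2 \<le> 0" using gd[of k] gN[of k] gN[of "Suc k"] that by simp
      then show ?thesis using \<alpha> by (simp add: mult_le_0_iff d_def)
    qed
    have "x k = x N" if "k \<ge> N" for k
      using that by (induction k rule: dec_induct) (simp_all add: step)
    then have "x \<longlonglongrightarrow> x N"
      by (intro tendsto_eventually eventually_sequentiallyI[of N])
    moreover have "global_minimizer f (x N)" by (rule min) (simp add: f N)
    ultimately show ?thesis by blast
  next
    case False
    then have gpos: "g k > 0" for k using g0[of k] by (metis less_le)
    have steep: "\<beta> \<le> d k * \<phi>' (g (Suc k))" for k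
    proof -
      have "ereal (1 / \<phi>' (g (Suc k))) \<le> limiting_slope f (x (Suc k))"
        by (rule limiting_slope_ge_inverse_deriv[OF m deriv pos cont KL f gpos g_lt])
      then have "ereal \<beta> * ereal (1 / \<phi>' (g (Suc k))) \<le> ereal \<beta> * limiting_slope f (x (Suc k))"
        using \<beta> by (intro ereal_mult_left_mono) auto
      also have "\<dots> \<le> ereal (d k)" using sl[of k] by (simp add: d_def)
      finally show ?thesis using pos[OF gpos[of "Suc k"]] by (simp add: field_simps)
    qed
    \<comment> \<open>The index is shifted because the second descent condition bounds the slope at
      the end point of step \<open>k\<close>, which is where step \<open>Suc k\<close> starts.
      Dividing by \<open>\<alpha> * \<beta>\<close> absorbs the constants.\<close>
    define p where "p k = \<phi> (g (Suc k)) / (\<alpha> * \<beta>)" for k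
    have d0: "d k \<ge> 0" for k by (simp add: d_def)
    have tangent: "\<phi>' (g k) * (\<alpha> * (d k)\<^sup>2) \<le> \<phi> (g k) - \<phi> (g (Suc k))" for k
    proof -
      have "\<phi>' (g k) * (\<alpha> * (d k)\<^sup>2) \<le> \<phi>' (g k) * (g k - g (Suc k))"
        using gd[of k] pos[OF gpos[of k]] by (intro mult_left_mono) auto
      also have "\<dots> \<le> \<phi> (g k) - \<phi> (g (Suc k))"
        by (rule concave_on_tangent_le[OF conc deriv[OF gpos] gpos g0])
      finally show ?thesis .
    qed
    have "summable d"
    proof (rule summable_if_square_le_telescoping[OF d0])
      fix k
      show "p k \<ge> 0"
        using desing gpos[of "Suc k"] \<alpha> \<beta> by (auto simp: p_def desingularizer_def Pi_iff)
      have "0 \<le> \<phi>' (g (Suc k)) * (\<alpha> * (d (Suc k))\<^sup>2)"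
        using pos[OF gpos[of "Suc k"]] \<alpha> by simp
      then have "\<phi> (g (Suc (Suc k))) \<le> \<phi> (g (Suc k))"
        using tangent[of "Suc k"] by linarith
      then show "p (Suc k) \<le> p k"
        using \<alpha> \<beta> by (simp add: p_def divide_right_mono)
      \<comment> \<open>Replacing \<open>\<beta>\<close> by \<open>steep\<close> produces exactly
        the factor \<open>\<phi>' (g (Suc k))\<close> that \<open>tangent\<close> at
        \<open>Suc k\<close> turns into a difference of values of \<open>\<phi>\<close>.\<close>
      have "\<alpha> * \<beta> * (d (Suc k))\<^sup>2 \<le> \<alpha> * (d k * \<phi>' (g (Suc k))) * (d (Suc k))\<^sup>2"
        using steep[of k] \<alpha> by (intro mult_right_mono mult_left_mono) auto
      also have "\<dots> = d k * (\<phi>' (g (Suc k)) * (\<alpha> * (d (Suc k))\<^sup>2))" by simp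
      also have "\<dots> \<le> d k * (\<phi> (g (Suc k)) - \<phi> (g (Suc (Suc k))))"
        by (rule mult_left_mono[OF tangent d0])
      finally show "(d (Suc k))\<^sup>2 \<le> d k * (p k - p (Suc k))"
        using \<alpha> \<beta> by (simp add: p_def field_simps)
    qed
    then have "Cauchy x" unfolding d_def by (rule Cauchy_if_summable_dist)
    then obtain z where z: "x \<longlonglongrightarrow> z"
      using Cauchy_convergent convergent_def by blast
    obtain l where l: "g \<longlonglongrightarrow> l" "\<And>k. l \<le> g k"
      using decseq_convergent[OF \<open>decseq g\<close>, of 0] g0 by blast
    have "l \<ge> 0" by (rule LIMSEQ_le_const[OF l(1)]) (use g0 in blast)
    have "l = 0"
    \<comment> \<open>At a positive limit \<open>\<phi>'\<close> is continuous, so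
      \<open>\<phi>' (g (Suc k))\<close> converges and the products in \<open>steep\<close> tend to
      0.\<close>
    proof (rule ccontr)
      assume "l \<noteq> 0"
      with \<open>l \<ge> 0\<close> have "l > 0" by simp
      then have "isCont \<phi>' l" using cont by (simp add: continuous_on_eq_continuous_at)
      then have "(\<lambda>k. d k * \<phi>' (g (Suc k))) \<longlonglongrightarrow> 0 * \<phi>' l"
        by (intro tendsto_mult summable_LIMSEQ_zero[OF \<open>summable d\<close>]
            isCont_tendsto_compose[OF _ LIMSEQ_Suc[OF l(1)]])
      then have "\<beta> \<le> 0 * \<phi>' l" by (rule LIMSEQ_le_const) (use steep in blast)
      with \<beta> show False by simp
    qed
    then have "(\<lambda>k. ereal (m + g k)) \<longlonglongrightarrow> ereal (m + 0)"
      using l(1) by (intro tendsto_intros) auto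
    then have "f z \<le> ereal m"
      by (intro lower_semicont_le_lim[OF lsc z]) (simp add: f)
    then show ?thesis using z min by blast
  qed
qed

theorem theorem5p4:
  fixes f :: "'a::complete_space \<Rightarrow> ereal"
    and \<phi> :: "real \<Rightarrow> real"
    and \<alpha> \<beta> :: real
  assumes "lower_semicont f"
    and "proper_fun f"
    and "bounded_below_fun f"
    and "KL_minimization f \<phi>"
    and "concave_on {0..} \<phi>"
    and "\<alpha> > 0" and "\<beta> > 0"
  shows "\<exists>\<epsilon>::real>0. \<forall>x :: nat \<Rightarrow> 'a.
    f (x 0) < (INF y. f y) + ereal \<epsilon> \<longrightarrow>
    (\<forall>k. f (x k) - f (x (Suc k)) \<ge> ereal (\<alpha> * (dist (x k) (x (Suc k)))\<^sup>2) \<and>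
         ereal (dist (x k) (x (Suc k))) \<ge> ereal \<beta> * limiting_slope f (x (Suc k))) \<longrightarrow>
    (\<exists>z. x \<longlonglongrightarrow> z \<and> global_minimizer f z)"
proof -
  obtain b where "\<And>y. ereal b \<le> f y"
    using assms(3) unfolding bounded_below_fun_def by blast
  then have lower: "ereal b \<le> (INF y. f y)" by (intro INF_greatest)
  obtain y where "f y < \<infinity>" using assms(2) unfolding proper_fun_def by blast
  then have "(INF y. f y) < \<infinity>" using INF_lower[of y UNIV f] by (meson UNIV_I le_less_trans)
  with lower obtain m where m: "(INF y. f y) = ereal m"
    by (cases "INF y. f y") auto
  have desing: "desingularizer \<phi>" using assms(4) by (simp add: KL_minimization_def)
  then obtain \<phi>' where \<phi>': "\<And>t. t > 0 \<Longrightarrow> (\<phi> has_real_derivative \<phi>' t) (at t)"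
    "\<And>t. t > 0 \<Longrightarrow> \<phi>' t > 0" "continuous_on {0<..} \<phi>'"
    unfolding desingularizer_def by blast
  obtain \<rho> :: real where \<rho>: "\<rho> > 0"
    "\<And>y. 0 < gap f y \<Longrightarrow> gap f y < ereal \<rho> \<Longrightarrow> slope (extend_desing \<phi> \<circ> gap f) y \<ge> 1"
    using assms(4) unfolding KL_minimization_def by blast
  show ?thesis
  proof (intro exI[of _ \<rho>] conjI allI impI \<rho>(1))
    fix x :: "nat \<Rightarrow> 'a"
    assume "f (x 0) < (INF y. f y) + ereal \<rho>"
      and "\<forall>k. f (x k) - f (x (Suc k)) \<ge> ereal (\<alpha> * (dist (x k) (x (Suc k)))\<^sup>2) \<and>
         ereal (dist (x k) (x (Suc k))) \<ge> ereal \<beta> * limiting_slope f (x (Suc k))"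
    then show "\<exists>z. x \<longlonglongrightarrow> z \<and> global_minimizer f z"
      by (intro KL_minimization_descent_converges[OF assms(1) m desing assms(5) \<phi>' \<rho>(2) assms(6,7)])
        (auto simp: m)
  qed
qed

end
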